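(* Let $M:\mathbb{R}^{n_1\times n_2\times n_3}\to\mathbb{R}^{N_1\times N_2}$ be a linear map such that for all $a\in\mathbb{R}^{n_1},b\in\mathbb{R}^{n_2},c\in\mathbb{R}^{n_3}$, $M(a\otimes b\otimes c)=A(a)\otimes(bc^\top)$ (Kronecker product), where $A(a)$ is a matrix whose entries are homogeneous degree-1 polynomials in the entries of $a$. Suppose that for some $r\ge1$ and generically chosen components $a^{(\ell)},b^{(\ell)},c^{(\ell)}$ ($\ell\in[r]$), $$\mathrm{rank}\Big(M\Big(\sum_{\ell=1}^r a^{(\ell)}\otimes b^{(\ell)}\otimes c^{(\ell)}\Big)\Big)=r\cdot\mathrm{rank}\big(M(a^{(1)}\otimes b^{(1)}\otimes c^{(1)})\big).$$ Then $r\le n_2+n_3$.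
   Context: "Generically chosen" means: the identity holds for all choices of the components outside the zero set of some nonidentically-zero polynomial in all coordinates of the components.
   Formalization: The formal statement additionally assumes that M is not the zero map; for M = 0 (A = 0) both ranks are 0, the identity holds for every r, and the bound r ≤ n_2 + n_3 fails. *)

theory Defs
  imports "HOL-Analysis.Analysis"
begin

text \<open>
  Order-three tensors in \<open>\<real>\<^bsup>n1 \<times> n2 \<times> n3\<^esup>\<close> are rendered as \<open>real^'n3^'n2^'n1\<close>, so that
  the entries are \<open>T $ i $ j $ k\<close>.
\<close>

definition tensor3 :: "real^'n1 \<Rightarrow> real^'n2 \<Rightarrow> real^'n3 \<Rightarrow> real^'n3^'n2^'n1" where
  "tensor3 a b c = (\<chi> i j k. a $ i * b $ j * c $ k)"

definition outer :: "real^'m \<Rightarrow> real^'n \<Rightarrow> real^'n^'m" where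
  "outer b c = (\<chi> j k. b $ j * c $ k)"

text \<open>
  The rows and columns of a Kronecker product are indexed by pairs instead of by numbers; the
  usual block layout is the lexicographic enumeration of these pairs.
\<close>

definition kronecker :: "real^'q^'p \<Rightarrow> real^'n^'m \<Rightarrow> real^('q \<times> 'n)^('p \<times> 'm)" where
  "kronecker A B = (\<chi> s t. A $ fst s $ fst t * B $ snd s $ snd t)"

definition homogeneous_degree_1 :: "(real^'n \<Rightarrow> real) \<Rightarrow> bool" where
  "homogeneous_degree_1 f \<longleftrightarrow> (\<exists>c :: real^'n. \<forall>x. f x = (\<Sum>k\<in>UNIV. c $ k * x $ k))"

text \<open>
  On a Euclidean space, \<^const>\<open>real_polynomial_function\<close> describes exactly the functions given by
  a real polynomial in the coordinates. Since \<open>\<real>\<close> is infinite, the polynomial is nonzero iff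
  the function is not identically zero.
\<close>

definition generically :: "('a::euclidean_space \<Rightarrow> bool) \<Rightarrow> bool" where
  "generically P \<longleftrightarrow>
    (\<exists>f. real_polynomial_function f \<and> (\<exists>x. f x \<noteq> 0) \<and> (\<forall>x. f x \<noteq> 0 \<longrightarrow> P x))"

end

theory Submission
  imports Defs
begin

text \<open>
  Let \<open>A\<^sub>0 = A(a\<^bsup>(1)\<^esup>)\<close> have the largest rank \<open>\<rho>\<close> that occurs on the open set where the rank identity is
  known. Since \<open>A\<^sub>0 + t A(d)\<close> has rank at most \<open>\<rho>\<close> for all small \<open>t\<close>, every \<open>A(d)\<close> maps
  \<open>ker A\<^sub>0\<close> into \<open>range A\<^sub>0\<close>. Hence every sum of matrices \<open>A(d) \<otimes> b c\<^sup>T\<close> maps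
  \<open>ker A\<^sub>0 \<otimes> \<real>\<^bsup>n3\<^esup>\<close>, a subspace of codimension \<open>\<rho> n3\<close>, into
  \<open>range A\<^sub>0 \<otimes> \<real>\<^bsup>n2\<^esup>\<close>, a subspace of dimension \<open>\<rho> n2\<close>, so its rank is at most
  \<open>\<rho> (n2 + n3)\<close>. A single summand with nonzero \<open>b\<close>, \<open>c\<close> has rank at least \<open>\<rho> > 0\<close>.
\<close>

section \<open>Rank under small perturbations of a matrix\<close>

lemma dim_le_rank_if_inj:
  fixes A :: "real^'n^'m"
  assumes "subspace S" and "\<And>x. x \<in> S \<Longrightarrow> A *v x = 0 \<Longrightarrow> x = 0"
  shows "dim S \<le> rank A"
proof -
  have "inj_on ((*v) A) (span S)"
    using assms linear_injective_on_subspace_0[of "(*v) A" S]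
    by (simp add: span_eq_iff[THEN iffD2])
  then have "dim ((*v) A ` S) = dim S"
    by (intro dim_image_eq) auto
  then show ?thesis
    by (metis dim_subset rank_dim_range subset_UNIV image_mono)
qed

text \<open>Otherwise \<open>B v\<close> is a direction independent of the range of
  \<open>A\<close>. For small \<open>t \<noteq> 0\<close>, \<open>A + t B\<close> is then injective
  on the row space of \<open>A\<close> extended by \<open>v\<close>, so its rank is at least
  \<open>rank A + 1\<close>.\<close>

lemma kernel_image_subset_range_if_rank_local_max:
  fixes A B :: "real^'n^'m"
  assumes le: "eventually (\<lambda>t. rank (A + t *\<^sub>R B) \<le> rank A) (at 0)" and v: "A *v v = 0"
  shows "B *v v \<in> range ((*v) A)"
proof (rule ccontr)
  define y where "y = B *v v"
  define W where "W = span (rows A)"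
  define L where "L = (\<lambda>p :: (real^'n) \<times> real. A *v fst p + snd p *\<^sub>R y)"
  assume "B *v v \<notin> range ((*v) A)"
  then have y: "y \<notin> range ((*v) A)" by (simp add: y_def)
  have "v \<noteq> 0"
    using y by (auto simp: y_def intro: range_eqI[of _ _ 0])
  then have "v \<notin> W"
    using v nullspace_inter_rowspace[of A v] by (auto simp: W_def)
  have linL: "linear L"
    unfolding L_def
    by (intro linearI) (auto simp: algebra_simps matrix_vector_right_distrib scaleR_matrix_vector_assoc
        matrix_vector_mult_scaleR)
  \<comment> \<open>\<open>A\<close> is injective on its row space \<open>W\<close>, and
    \<open>y\<close> lies outside the range of \<open>A\<close>. In finite dimension, injectivity of
    \<open>L\<close> on \<open>W \<times> UNIV\<close> yields a uniform lower bound
    \<open>e\<close>, which survives small perturbations.\<close>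
  have Linj: "p = 0" if "p \<in> W \<times> UNIV" "L p = 0" for p
  proof -
    have eq: "A *v fst p = - (snd p *\<^sub>R y)"
      using that(2) by (simp add: L_def eq_neg_iff_add_eq_0)
    have "snd p = 0"
    proof (rule ccontr)
      assume "snd p \<noteq> 0"
      then have "y = A *v ((- 1 / snd p) *\<^sub>R fst p)"
        by (simp only: matrix_vector_mult_scaleR eq) simp
      then show False using y by blast
    qed
    moreover from this have "fst p = 0"
      using eq that(1) nullspace_inter_rowspace[of A "fst p"] by (auto simp: W_def)
    ultimately show ?thesis by (simp add: prod_eq_iff)
  qed
  have "subspace (W \<times> (UNIV :: real set))"
    unfolding W_def by (intro subspace_Times) auto
  then obtain e where e: "e > 0" "\<And>p. p \<in> W \<times> UNIV \<Longrightarrow> e * norm p \<le> norm (L p)"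
    using injective_imp_isometric[of "W \<times> UNIV" L] Linj linL
    by (auto simp: closed_subspace linear_conv_bounded_linear)
  obtain C where C: "C > 0" "\<And>x. norm (B *v x) \<le> C * norm x"
    using linear_bounded_pos[of "(*v) B"] by (auto simp: mult.commute)
  \<comment> \<open>Below the threshold \<open>e / C\<close>, the perturbation \<open>t B\<close>
    has norm bound \<open>\<bar>t\<bar> * C < e\<close>, too small to cancel
    \<open>L\<close>.\<close>
  have "eventually (\<lambda>t :: real. \<bar>t\<bar> < e / C) (at 0)"
    using e C by (auto simp: eventually_at intro!: exI[of _ "e / C"])
  moreover have "eventually (\<lambda>t :: real. t \<noteq> 0) (at 0)"
    by (simp add: eventually_at_filter)
  ultimately have "eventually (\<lambda>t. \<bar>t\<bar> < e / C \<and> t \<noteq> 0 \<and> rank (A + t *\<^sub>R B) \<le> rank A) (at 0)"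
    using le by eventually_elim auto
  then obtain t where t: "\<bar>t\<bar> < e / C" "t \<noteq> 0" "rank (A + t *\<^sub>R B) \<le> rank A"
    using eventually_happens[of _ "at (0::real)"] by auto
  \<comment> \<open>\<open>(A + t B) (w + k v) = L (w, t k) + t B w\<close>, and \<open>L\<close> dominates the perturbation \<open>t B w\<close>.\<close>
  have "dim (span (insert v W)) \<le> rank (A + t *\<^sub>R B)"
  proof (rule dim_le_rank_if_inj)
    fix x assume x: "x \<in> span (insert v W)" and x0: "(A + t *\<^sub>R B) *v x = 0"
    obtain k where k: "x - k *\<^sub>R v \<in> W"
      using x by (auto simp: span_breakdown_eq W_def span_span)
    define w where "w = x - k *\<^sub>R v"
    have xw: "x = w + k *\<^sub>R v" by (simp add: w_def)
    have "L (w, t * k) = - (t *\<^sub>R (B *v w))"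
      using x0 v unfolding xw L_def y_def
      by (simp add: matrix_vector_mult_add_rdistrib matrix_vector_right_distrib
          scaleR_matrix_vector_assoc[symmetric] matrix_vector_mult_scaleR algebra_simps
          eq_neg_iff_add_eq_0)
    then have "e * norm (w, t * k) \<le> \<bar>t\<bar> * norm (B *v w)"
      using e(2)[of "(w, t * k)"] k by (simp add: w_def)
    also have "\<dots> \<le> \<bar>t\<bar> * (C * norm (w, t * k))"
      using C(2)[of w] norm_fst_le[of w "t * k"] C(1)
      by (intro mult_left_mono order_trans[OF C(2)]) auto
    finally have "(e - \<bar>t\<bar> * C) * norm (w, t * k) \<le> 0"
      by (simp add: algebra_simps)
    moreover have "e - \<bar>t\<bar> * C > 0"
      using t(1) C(1) by (simp add: field_simps)
    ultimately have "(w, t * k) = 0"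
      by (metis mult_pos_pos norm_eq_zero not_less zero_less_norm_iff)
    then show "x = 0" using t(2) by (simp add: xw zero_prod_def)
  qed auto
  moreover have "dim (span (insert v W)) = rank A + 1"
    using \<open>v \<notin> W\<close> by (simp add: dim_insert row_rank_def W_def span_span)
  ultimately show False using t(3) by simp
qed

section \<open>Slices of vectors indexed by pairs, and ranks of Kronecker products\<close>

definition slice :: "'m::finite \<Rightarrow> real^('n::finite \<times> 'm) \<Rightarrow> real^'n" where
  "slice j x = (\<chi> i. x $ (i, j))"

text \<open>This is the subspace \<open>S \<otimes> \<real>\<^sup>m\<close> when \<open>S\<close> is
  a subspace.\<close>

definition slices_in :: "(real^'n::finite) set \<Rightarrow> (real^('n \<times> 'm::finite)) set" where
  "slices_in S = {x. \<forall>j. slice j x \<in> S}"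

lemma linear_slice: "linear (slice j)"
  by (auto simp: linear_iff slice_def vec_eq_iff)

lemma subspace_slices_in:
  assumes "subspace S"
  shows "subspace (slices_in S)"
  using assms
  by (auto simp: subspace_def slices_in_def linear_0[OF linear_slice] linear_add[OF linear_slice]
      linear_scale[OF linear_slice])

text \<open>One copy of a basis of \<open>S\<close> in each slice, placed there by
  \<open>E j\<close>, gives a spanning set.\<close>

lemma dim_slices_in_le:
  fixes S :: "(real^'n) set"
  shows "dim (slices_in S :: (real^('n \<times> 'm::finite)) set) \<le> dim S * CARD('m)"
proof -
  define E where "E = (\<lambda>j (r :: real^'n). (\<chi> s. if snd s = j then r $ fst s else 0) :: real^('n \<times> 'm))"
  have linE: "linear (E j)" for j
    by (auto simp: linear_iff E_def vec_eq_iff)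
  obtain B where B: "B \<subseteq> S" "independent B" "S \<subseteq> span B" "card B = dim S"
    using basis_exists[of S] by blast
  have "finite B" using B(2) by (rule independent_imp_finite)
  define G where "G = (\<Union>j\<in>UNIV. E j ` B)"
  have "slices_in S \<subseteq> span G"
  proof
    fix y :: "real^('n \<times> 'm)" assume y: "y \<in> slices_in S"
    have "E j (slice j y) \<in> span G" for j
    proof -
      have "E j (slice j y) \<in> E j ` span B"
        using y B(3) by (auto simp: slices_in_def)
      also have "\<dots> = span (E j ` B)"
        using linear_span_image[OF linE] by simp
      also have "\<dots> \<subseteq> span G"
        by (intro span_mono) (auto simp: G_def)
      finally show ?thesis .
    qed
    then have "(\<Sum>j\<in>UNIV. E j (slice j y)) \<in> span G"
      by (intro span_sum) auto
    moreover have "(\<Sum>j\<in>UNIV. E j (slice j y)) = y"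
      by (auto simp: vec_eq_iff E_def slice_def)
    ultimately show "y \<in> span G" by simp
  qed
  moreover have "finite G" using \<open>finite B\<close> by (auto simp: G_def)
  ultimately have "dim (slices_in S :: (real^('n \<times> 'm)) set) \<le> card G"
    by (rule dim_le_card)
  also have "\<dots> \<le> (\<Sum>j\<in>(UNIV::'m set). card (E j ` B))"
    unfolding G_def by (rule card_UN_le) simp
  also have "\<dots> \<le> (\<Sum>j\<in>(UNIV::'m set). dim S)"
    using card_image_le[OF \<open>finite B\<close>] B(4) by (intro sum_mono) simp
  finally show ?thesis by (simp add: mult.commute)
qed

text \<open>Reading \<open>x\<close> as the matrix \<open>X\<close> with columns
  \<open>slice k x\<close>, the product acts as \<open>X \<mapsto> A X c b^T\<close>.\<close>

lemma slice_kronecker_outer: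
  "slice j (kronecker A (outer b c) *v x) = (\<Sum>k\<in>UNIV. (b $ j * c $ k) *\<^sub>R (A *v slice k x))"
proof -
  have "(kronecker A (outer b c) *v x) $ (i, j)
      = (\<Sum>k\<in>UNIV. b $ j * c $ k * (\<Sum>m\<in>UNIV. A $ i $ m * x $ (m, k)))" for i
  proof -
    have "(kronecker A (outer b c) *v x) $ (i, j)
        = (\<Sum>(m, k)\<in>UNIV \<times> UNIV. A $ i $ m * (b $ j * c $ k) * x $ (m, k))"
      by (simp add: matrix_vector_mult_def kronecker_def outer_def case_prod_unfold)
    also have "\<dots> = (\<Sum>m\<in>UNIV. \<Sum>k\<in>UNIV. A $ i $ m * (b $ j * c $ k) * x $ (m, k))"
      by (simp add: sum.cartesian_product)
    also have "\<dots> = (\<Sum>k\<in>UNIV. \<Sum>m\<in>UNIV. A $ i $ m * (b $ j * c $ k) * x $ (m, k))"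
      by (rule sum.swap)
    finally show ?thesis by (simp add: sum_distrib_left mult_ac)
  qed
  then show ?thesis
    by (simp add: vec_eq_iff slice_def matrix_vector_mult_def)
qed

text \<open>Splitting each slice of the argument along \<open>ker A0\<close> and the row space of
  \<open>A0\<close>, the kernel part is sent into \<open>slices_in R\<close>. The row space part
  ranges over a space of dimension at most \<open>rank A0 * CARD('n)\<close>, so its image is no
  larger.\<close>

lemma rank_sum_kronecker_le:
  fixes A :: "'r \<Rightarrow> real^'q^'p" and A0 :: "real^'q^'p" and b :: "'r \<Rightarrow> real^'m"
    and c :: "'r \<Rightarrow> real^'n"
  assumes sub: "\<And>l v. l \<in> I \<Longrightarrow> A0 *v v = 0 \<Longrightarrow> A l *v v \<in> range ((*v) A0)"
  shows "rank (\<Sum>l\<in>I. kronecker (A l) (outer (b l) (c l))) \<le> rank A0 * (CARD('m) + CARD('n))"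
proof -
  define N where "N = (\<Sum>l\<in>I. kronecker (A l) (outer (b l) (c l)))"
  define R where "R = range ((*v) A0)"
  define W where "W = span (rows A0)"
  let ?RS = "slices_in R :: (real^('p \<times> 'm)) set"
  let ?WS = "slices_in W :: (real^('q \<times> 'n)) set"
  have subR: "subspace R"
    unfolding R_def by (intro linear_subspace_image) auto
  have Nx: "N *v x = (\<Sum>l\<in>I. kronecker (A l) (outer (b l) (c l)) *v x)" for x
    unfolding N_def by (induction I rule: infinite_finite_induct)
      (auto simp: matrix_vector_mult_add_rdistrib)
  have split: "\<exists>u w. N *v x = u + w \<and> u \<in> ?RS \<and> w \<in> (*v) N ` ?WS" for x
  proof -
    have "\<exists>w z. w \<in> W \<and> A0 *v z = 0 \<and> slice k x = w + z" for k
    proof -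
      obtain w z where wz: "w \<in> span (rows A0)" "\<And>u. u \<in> span (rows A0) \<Longrightarrow> orthogonal z u"
        "slice k x = w + z"
        using orthogonal_subspace_decomp_exists[of "rows A0" "slice k x"] by metis
      have "A0 *v z = 0"
        using wz(2)[OF span_base, of "row _ A0"]
        by (auto simp: vec_eq_iff matrix_mult_dot orthogonal_def inner_commute rows_def row_def)
      then show ?thesis using wz unfolding W_def by blast
    qed
    then obtain w z where w: "\<And>k. w k \<in> W" and z: "\<And>k. A0 *v z k = 0"
      and wz: "\<And>k. slice k x = w k + z k" by metis
    define xw :: "real^('q \<times> 'n)" where "xw = (\<chi> s. w (snd s) $ fst s)"
    define xz :: "real^('q \<times> 'n)" where "xz = (\<chi> s. z (snd s) $ fst s)"
    have slw: "slice k xw = w k" and slz: "slice k xz = z k" for k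
      by (auto simp: slice_def xw_def xz_def vec_eq_iff)
    have "x = xz + xw"
      using wz by (auto simp: vec_eq_iff slice_def xw_def xz_def)
    then have "N *v x = N *v xz + N *v xw"
      by (simp add: matrix_vector_right_distrib)
    moreover have "N *v xz \<in> ?RS"
    \<comment> \<open>Every slice of the image is a linear combination of vectors
      \<open>A l *v z k\<close>, which lie in \<open>R\<close> by \<open>sub\<close>; the factors
      \<open>b\<close> and \<open>c\<close> enter only through the coefficients.\<close>
    proof -
      have "slice j (N *v xz) = (\<Sum>l\<in>I. \<Sum>k\<in>UNIV. (b l $ j * c l $ k) *\<^sub>R (A l *v z k))" for j
        by (simp add: Nx linear_sum[OF linear_slice] slice_kronecker_outer slz)
      moreover have "\<dots> j \<in> R" for j
        by (intro subspace_sum[OF subR] subspace_scale[OF subR]) (use sub z in \<open>auto simp: R_def\<close>)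
      ultimately show ?thesis by (simp add: slices_in_def)
    qed
    moreover have "xw \<in> ?WS" using w by (simp add: slices_in_def slw)
    ultimately show ?thesis by blast
  qed
  have sWS: "subspace ?WS" unfolding W_def by (intro subspace_slices_in) simp
  have "rank N = dim (range ((*v) N))" by (rule rank_dim_range)
  also have "\<dots> \<le> dim {u + w |u w. u \<in> ?RS \<and> w \<in> (*v) N ` ?WS}"
    using split by (intro dim_subset) blast
  also have "\<dots> \<le> dim ?RS + dim ((*v) N ` ?WS)"
    using dim_sums_Int[OF subspace_slices_in[OF subR] linear_subspace_image[OF _ sWS, of "(*v) N"]]
    by simp
  also have "dim ((*v) N ` ?WS) \<le> dim ?WS"
    by (intro dim_image_le) auto
  also have "dim ?RS + dim ?WS \<le> dim R * CARD('m) + dim W * CARD('n)"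
    by (intro add_mono dim_slices_in_le)
  also have "dim R = rank A0" by (simp add: R_def rank_dim_range)
  also have "dim W = rank A0" by (simp add: W_def row_rank_def)
  finally show ?thesis by (simp add: N_def algebra_simps)
qed

text \<open>The map \<open>T\<close> is \<open>w \<mapsto> w \<otimes> c\<close>, and the product
  sends \<open>w \<otimes> c\<close> to \<open>|c|^2 (A w) \<otimes> b\<close>. It is therefore
  injective on the image under \<open>T\<close> of the row space of \<open>A\<close>.\<close>

lemma rank_le_rank_kronecker_outer:
  fixes A :: "real^'q^'p" and b :: "real^'m" and c :: "real^'n"
  assumes "b \<noteq> 0" "c \<noteq> 0"
  shows "rank A \<le> rank (kronecker A (outer b c))"
proof -
  define T :: "real^'q \<Rightarrow> real^('q \<times> 'n)" where "T = (\<lambda>w. \<chi> t. c $ snd t * w $ fst t)"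
  have linT: "linear T"
    by (auto simp: linear_iff T_def vec_eq_iff algebra_simps)
  have slT: "slice k (T w) = c $ k *\<^sub>R w" for k w
    by (simp add: slice_def T_def vec_eq_iff)
  obtain j k where jk: "b $ j \<noteq> 0" "c $ k \<noteq> 0"
    using assms by (auto simp: vec_eq_iff)
  have "inj T"
    using jk(2) slT by (metis injI scaleR_left_imp_eq)
  then have "dim (T ` span (rows A)) = rank A"
    using dim_image_eq[OF linT, of "span (rows A)"] by (simp add: row_rank_def inj_on_subset)
  moreover have "dim (T ` span (rows A)) \<le> rank (kronecker A (outer b c))"
  proof (rule dim_le_rank_if_inj)
    fix x assume "x \<in> T ` span (rows A)" and x0: "kronecker A (outer b c) *v x = 0"
    then obtain w where w: "w \<in> span (rows A)" "x = T w" by blast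
    have "(b $ j * (\<Sum>k\<in>UNIV. c $ k * c $ k)) *\<^sub>R (A *v w) = slice j (kronecker A (outer b c) *v x)"
      by (simp add: slice_kronecker_outer w slT matrix_vector_mult_scaleR sum_distrib_left
          scaleR_sum_left mult_ac)
    moreover have "(\<Sum>k\<in>UNIV. c $ k * c $ k) \<noteq> 0"
      using assms(2) inner_eq_zero_iff[of c] by (simp only: inner_vec_def inner_real_def) simp
    ultimately have "A *v w = 0"
      using jk(1) by (simp add: x0 linear_0[OF linear_slice])
    then show "x = 0"
      using w nullspace_inter_rowspace[of A w] linear_0[OF linT] by auto
  qed (intro linear_subspace_image linT subspace_span)
  ultimately show ?thesis by simp
qed

section \<open>Linearity, rank-one tensors and perturbation along lines\<close>

lemma linear_if_homogeneous_degree_1: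
  fixes A :: "real^'n \<Rightarrow> real^'q^'p"
  assumes "\<And>i j. homogeneous_degree_1 (\<lambda>a. A a $ i $ j)"
  shows "linear A"
proof -
  obtain C where C: "\<And>i j x. A x $ i $ j = (\<Sum>k\<in>UNIV. C i j $ k * x $ k)"
    using assms unfolding homogeneous_degree_1_def by metis
  show ?thesis
    by (intro linearI) (auto simp: vec_eq_iff C algebra_simps sum.distrib sum_distrib_left)
qed

lemma tensor3_decomposition:
  "T = (\<Sum>i\<in>UNIV. \<Sum>j\<in>UNIV. \<Sum>k\<in>UNIV. T $ i $ j $ k *\<^sub>R tensor3 (axis i 1) (axis j 1) (axis k 1))"
proof -
  have "(\<Sum>i\<in>UNIV. \<Sum>j\<in>UNIV. \<Sum>k\<in>UNIV. T $ i $ j $ k *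
      (axis i 1 $ i' * axis j 1 $ j' * axis k 1 $ k')) = T $ i' $ j' $ k'" for i' j' k'
  proof -
    have "(\<Sum>i\<in>UNIV. \<Sum>j\<in>UNIV. \<Sum>k\<in>UNIV. T $ i $ j $ k *
        (axis i 1 $ i' * axis j 1 $ j' * axis k 1 $ k'))
      = (\<Sum>i\<in>UNIV. \<Sum>j\<in>UNIV. \<Sum>k\<in>UNIV.
          if k = k' then if j = j' then if i = i' then T $ i $ j $ k else 0 else 0 else 0)"
      by (intro sum.cong refl) (auto simp: axis_def)
    then show ?thesis by (simp add: sum.delta)
  qed
  then show ?thesis
    by (simp add: vec_eq_iff tensor3_def)
qed

text \<open>Rank-one tensors of basis vectors span the tensor space. This is what turns
  \<open>M \<noteq> 0\<close> into the existence of some \<open>A e \<noteq> 0\<close>.\<close>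

lemma linear_eq_0_if_tensor3:
  fixes M :: "real^'n3^'n2^'n1 \<Rightarrow> 'a::real_vector"
  assumes "linear M" and "\<And>a b c. M (tensor3 a b c) = 0"
  shows "M T = 0"
  by (subst tensor3_decomposition)
    (simp add: assms linear_sum[OF assms(1)] linear_scale[OF assms(1)])

lemma eventually_add_scaleR_neq_0:
  fixes x d :: "'a::real_normed_vector"
  assumes "d \<noteq> 0"
  shows "eventually (\<lambda>t. x + t *\<^sub>R d \<noteq> 0) (at 0)"
proof (cases "x = 0")
  case True
  then show ?thesis using assms by (simp add: eventually_at_filter)
next
  case False
  have "((\<lambda>t. x + t *\<^sub>R d) \<longlongrightarrow> x + 0 *\<^sub>R d) (at 0)"
    by (intro tendsto_intros)
  then show ?thesis
    using False by (intro tendsto_imp_eventually_ne[of _ x]) auto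
qed

section \<open>Comparison of ranks at a generic point of maximal rank\<close>

theorem theorem2p10:
  fixes M :: "real^'n3::finite^'n2::finite^'n1::finite \<Rightarrow> real^('q::finite \<times> 'n3)^('p::finite \<times> 'n2)"
    and A :: "real^'n1 \<Rightarrow> real^'q^'p"
    and l1 :: "'r::finite"
  assumes "linear M"
    and "M \<noteq> (\<lambda>T. 0)"
    and "\<And>i j. homogeneous_degree_1 (\<lambda>a. A a $ i $ j)"
    and "\<And>a b c. M (tensor3 a b c) = kronecker (A a) (outer b c)"
    and "generically (\<lambda>(a :: real^'n1^'r, b :: real^'n2^'r, c :: real^'n3^'r).
           rank (M (\<Sum>l\<in>UNIV. tensor3 (a $ l) (b $ l) (c $ l)))
             = CARD('r) * rank (M (tensor3 (a $ l1) (b $ l1) (c $ l1))))"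
  shows "CARD('r) \<le> CARD('n2) + CARD('n3)"
proof -
  note M = assms(1) and MA = assms(4)
  have A: "linear A" using assms(3) by (rule linear_if_homogeneous_degree_1)
  obtain f :: "(real^'n1^'r) \<times> (real^'n2^'r) \<times> (real^'n3^'r) \<Rightarrow> real" and x0
    where f: "real_polynomial_function f" and x0: "f x0 \<noteq> 0"
      and gen: "\<And>a b c. f (a, b, c) \<noteq> 0 \<Longrightarrow>
        rank (M (\<Sum>l\<in>UNIV. tensor3 (a $ l) (b $ l) (c $ l)))
             = CARD('r) * rank (M (tensor3 (a $ l1) (b $ l1) (c $ l1)))"
    using assms(5) unfolding generically_def by fast
  \<comment> \<open>Of the polynomial \<open>f\<close> only continuity matters here: near a point
    where \<open>f\<close> is nonzero, it stays nonzero along every line.\<close>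
  have ev: "eventually (\<lambda>t. f (x + t *\<^sub>R d) \<noteq> 0) (at 0)" if "f x \<noteq> 0" for x d
  proof -
    have "((\<lambda>t. x + t *\<^sub>R d) \<longlongrightarrow> x + 0 *\<^sub>R d) (at 0)"
      by (intro tendsto_intros)
    then have "((\<lambda>t. f (x + t *\<^sub>R d)) \<longlongrightarrow> f x) (at 0)"
      using isCont_tendsto_compose[OF continuous_real_polymonial_function[OF f, of x]] by simp
    then show ?thesis using that by (rule tendsto_imp_eventually_ne)
  qed
  obtain e where e: "A e \<noteq> 0"
  proof (rule ccontr)
    assume "\<not> thesis"
    with that have "A a = 0" for a by blast
    then have "M (tensor3 a b c) = 0" for a b c
      by (simp add: MA kronecker_def vec_eq_iff)
    then show False
      using linear_eq_0_if_tensor3[OF M] assms(2) by blast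
  qed
  \<comment> \<open>The extra conditions make \<open>rank (A (a $ l1))\<close> positive and allow
    the lower bound for a single summand.\<close>
  define good where "good = (\<lambda>(a :: real^'n1^'r, b :: real^'n2^'r, c :: real^'n3^'r).
    f (a, b, c) \<noteq> 0 \<and> A (a $ l1) \<noteq> 0 \<and> b $ l1 \<noteq> 0 \<and> c $ l1 \<noteq> 0)"
  have "\<exists>x. good x"
  proof -
    obtain a b c where abc: "x0 = (a, b, c)" by (cases x0)
    \<comment> \<open>Moving every \<open>a $ l\<close> along \<open>e\<close> and every
      \<open>b $ l\<close>, \<open>c $ l\<close> along the all-ones vector leaves the zero sets of
      all three extra conditions, while small steps keep \<open>f\<close> nonzero.\<close>
    let ?d = "(\<chi> l. e, \<chi> l. 1, \<chi> l. 1) :: (real^'n1^'r) \<times> (real^'n2^'r) \<times> (real^'n3^'r)"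
    have "eventually (\<lambda>t. f (x0 + t *\<^sub>R ?d) \<noteq> 0) (at 0)" using x0 by (rule ev)
    moreover have "eventually (\<lambda>t. A (a $ l1) + t *\<^sub>R A e \<noteq> 0) (at 0)"
      using e by (rule eventually_add_scaleR_neq_0)
    moreover have "eventually (\<lambda>t. b $ l1 + t *\<^sub>R 1 \<noteq> 0) (at 0)"
      by (rule eventually_add_scaleR_neq_0) (simp add: vec_eq_iff)
    moreover have "eventually (\<lambda>t. c $ l1 + t *\<^sub>R 1 \<noteq> 0) (at 0)"
      by (rule eventually_add_scaleR_neq_0) (simp add: vec_eq_iff)
    ultimately have "eventually (\<lambda>t. good (x0 + t *\<^sub>R ?d)) (at 0)"
      by eventually_elim (simp add: good_def abc linear_add[OF A] linear_scale[OF A])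
    then show ?thesis
      by (meson eventually_happens trivial_limit_at)
  qed
  then obtain x1 where x1: "good x1" ..
  have "rank (A (fst y $ l1)) < Suc CARD('q)"
    for y :: "(real^'n1^'r) \<times> (real^'n2^'r) \<times> (real^'n3^'r)"
    using rank_bound[of "A (fst y $ l1)"] by (simp add: less_Suc_eq_le)
  then obtain x where x: "good x"
    and max: "\<And>y. good y \<Longrightarrow> rank (A (fst y $ l1)) \<le> rank (A (fst x $ l1))"
    using ex_has_greatest_nat[of good x1 "\<lambda>x. rank (A (fst x $ l1))" "Suc CARD('q)", OF x1] by blast
  obtain a b c where abc: "x = (a, b, c)" by (cases x)
  have good: "f (a, b, c) \<noteq> 0" "A (a $ l1) \<noteq> 0" "b $ l1 \<noteq> 0" "c $ l1 \<noteq> 0"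
    using x by (auto simp: good_def abc)
  let ?\<rho> = "rank (A (a $ l1))"
  have sub: "A d *v v \<in> range ((*v) (A (a $ l1)))" if "A (a $ l1) *v v = 0" for d v
  proof (rule kernel_image_subset_range_if_rank_local_max[OF _ that])
    \<comment> \<open>All \<open>a $ l\<close> move along \<open>d\<close>, with \<open>b\<close>
      and \<open>c\<close> fixed. The new point is good, and maximality applies, unless the
      perturbed matrix vanishes and has rank 0. As \<open>d\<close> is arbitrary, the inclusion
      covers every \<open>A (a $ l)\<close>.\<close>
    have "eventually (\<lambda>t. f ((a, b, c) + t *\<^sub>R (\<chi> l. d, 0, 0)) \<noteq> 0) (at 0)"
      using good(1) by (rule ev)
    then show "eventually (\<lambda>t. rank (A (a $ l1) + t *\<^sub>R A d) \<le> ?\<rho>) (at 0)"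
    proof eventually_elim
      case (elim t)
      show ?case
      proof (cases "A (a $ l1) + t *\<^sub>R A d = 0")
        case False
        then have "good ((a, b, c) + t *\<^sub>R (\<chi> l. d, 0, 0))"
          using elim good by (simp add: good_def linear_add[OF A] linear_scale[OF A])
        from max[OF this] show ?thesis
          by (simp add: abc linear_add[OF A] linear_scale[OF A])
      qed simp
    qed
  qed
  \<comment> \<open>The single summand bounds the generic rank from below and the sum bounds it from
    above; the positive factor \<open>?\<rho>\<close> then cancels.\<close>
  have "CARD('r) * ?\<rho> \<le> CARD('r) * rank (M (tensor3 (a $ l1) (b $ l1) (c $ l1)))"
    using rank_le_rank_kronecker_outer[OF good(3,4)] by (simp add: MA)
  also have "\<dots> = rank (\<Sum>l\<in>UNIV. kronecker (A (a $ l)) (outer (b $ l) (c $ l)))"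
    using gen[OF good(1)] by (simp add: linear_sum[OF M] MA)
  also have "\<dots> \<le> ?\<rho> * (CARD('n2) + CARD('n3))"
    using sub by (intro rank_sum_kronecker_le) auto
  finally show ?thesis
    using good(2) rank_eq_0[of "A (a $ l1)"] by (simp add: mult.commute)
qed

end
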